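(* Let $f:\mathbb{E}\to\mathbb{R}\cup\{+\infty\}$ be a proper extended real function, $\bar x\in\mathrm{dom}\,f$, and let $n$ be a positive integer with $n\ge2$. Then $\bar x$ is an isolated local minimizer of order $n$ of $f$ if and only if \[ 0\in\partial^{(1)}_- f(\bar x),\qquad 0\in\partial^{(i)}_- f(\bar x;\underbrace{0,\dots,0}_{(i-1)\text{ times}})\quad\text{for all integers } i \text{ with } 2\le i\le n-1, \] and \[ f^{(n)}_-(\bar x;\underbrace{0,0,\dots,0}_{(n-1)\text{ times}};u)>0\quad\text{for all } u\in\mathbb{E}\setminus\{0\}. \]
   Context: $\mathbb{E}$ is a real finite-dimensional Euclidean space. $L^1(\mathbb{E})=L(\mathbb{E},\mathbb{R})$ is the space of continuous linear functionals, and $L^n(\mathbb{E})=L(\mathbb{E},L^{n-1}(\mathbb{E}))$ for $n>1$. A function $f:\mathbb{E}\to\mathbb{R}\cup\{+\infty\}$ is called a proper extended real function (it never takes the value $-\infty$), and $\mathrm{dom}\,f=\{x\in\mathbb{E}\mid f(x)<+\infty\}$. For $x\in\mathrm{dom}\,f$ and $u\in\mathbb{E}$, the lower Hadamard directional derivative is \[ f^{(1)}_-(x;u)=\liminf_{t\downarrow 0,\,u'\to u} t^{-1}[f(x+tu')-f(x)] \] (here $t\to0$ through positive values and $\|u'-u\|\to 0$), and the lower Hadamard subdifferential is $\partial^{(1)}_- f(x)=\{x^*\in L^1(\mathbb{E})\mid x^*(u)\le f^{(1)}_-(x;u)\ \forall u\in\mathbb{E}\}$. Recursively, for an integer $n\ge2$,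 given $x_1^*\in\partial^{(1)}_- f(x)$ and $x_i^*\in\partial^{(i)}_- f(x;x_1^*,\dots,x_{i-1}^* )$ for $i=2,\dots,n-1$, the lower derivative of Hadamard type of order $n$ is the element of $[-\infty,+\infty]$ \[ f^{(n)}_-(x;x_1^*,\dots,x_{n-1}^*;u)=\liminf_{t\downarrow0,\,u'\to u} n!\,t^{-n}\Big[f(x+tu')-f(x)-\sum_{i=1}^{n-1}\frac{t^i}{i!}\,x_i^*\underbrace{(u')\dots(u')}_{i\text{ times}}\Big], \] and the lower subdifferential of Hadamard type of order $n$ is \[ \partial^{(n)}_- f(x;x_1^*,\dots,x_{n-1}^* )=\{x^*\in L^n(\mathbb{E})\mid x^*\underbrace{(u)\dots(u)}_{n\text{ times}}\le f^{(n)}_-(x;x_1^*,\dots,x_{n-1}^*;u)\ \forall u\in\mathbb{E}\}. \] A point $\bar x\in\mathrm{dom}\,f$ is an isolated local minimizer of order $n$ of $f$ iff there exist a neighbourhood $N$ of $\bar x$ and a constant $C>0$ with $f(x)\ge f(\bar x)+C\|x-\bar x\|^n$ for all $x\in N$. *)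

theory Defs
  imports "HOL-Analysis.Analysis"
begin

text \<open>
  The type of an element of \<open>L\<^sup>n(E)\<close> would depend on the number \<open>n\<close>, so the spaces are carrier
  sets in one type: \<open>F\<close> represents the functional whose value \<open>F(u\<^sub>1)(u\<^sub>2)\<dots>(u\<^sub>n)\<close> is
  \<open>F [u\<^sub>1, u\<^sub>2, \<dots>, u\<^sub>n]\<close>, and \<open>F\<close> is \<open>0\<close> on lists of any other length, which makes the
  representation unique. The element \<open>F(u)\<close> of \<open>L\<^sup>n\<^sup>-\<^sup>1(E)\<close> is \<open>\<lambda>us. F (u # us)\<close>, and the zero
  of every \<open>L\<^sup>n(E)\<close> is \<open>\<lambda>us. 0\<close>.
\<close>

type_synonym 'a form = "'a list \<Rightarrow> real"

text \<open>The norm of \<open>L\<^sup>n(E) = L(E, L\<^sup>n\<^sup>-\<^sup>1(E))\<close>, in the format of \<^const>\<open>onorm\<close>.\<close>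

primrec form_norm :: "nat \<Rightarrow> ('a::real_normed_vector) form \<Rightarrow> real" where
  "form_norm 0 F = \<bar>F []\<bar>"
| "form_norm (Suc n) F = (SUP u. form_norm n (\<lambda>us. F (u # us)) / norm u)"

text \<open>
  The recursion starts from \<open>L\<^sup>0(E) = \<real>\<close>, so that \<open>L\<^sup>1(E) = L(E, \<real>)\<close>. The last conjunct is
  continuity of the linear map \<open>E \<rightarrow> L\<^sup>n(E)\<close>.
\<close>

primrec form_space :: "nat \<Rightarrow> ('a::real_normed_vector) form set" where
  "form_space 0 = {F. \<forall>us. us \<noteq> [] \<longrightarrow> F us = 0}"
| "form_space (Suc n) = {F. F [] = 0
      \<and> (\<forall>u. (\<lambda>us. F (u # us)) \<in> form_space n)
      \<and> (\<forall>us. linear (\<lambda>u. F (u # us)))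
      \<and> (\<exists>K. \<forall>u. form_norm n (\<lambda>us. F (u # us)) \<le> K * norm u)}"

lemma zero_in_form_space: "(\<lambda>us. 0) \<in> (form_space n :: ('a::real_normed_vector) form set)"
proof -
  have "form_norm n ((\<lambda>us. 0) :: 'a form) = 0 \<and> (\<lambda>us. 0) \<in> (form_space n :: 'a form set)"
    by (induction n) (auto simp: linear_iff intro!: exI[of _ 0])
  then show ?thesis by blast
qed

text \<open>Agreement with the library's continuous linear functionals and their norm.\<close>

lemma form_space_1_iff:
  fixes F :: "('a::real_normed_vector) form"
  shows "F \<in> form_space 1 \<longleftrightarrow>
    (\<exists>g :: 'a \<Rightarrow>\<^sub>L real. F = (\<lambda>us. case us of [u] \<Rightarrow> blinfun_apply g u | _ \<Rightarrow> 0))"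
proof
  assume "F \<in> form_space 1"
  then obtain K where F: "F [] = 0" "\<And>u us. us \<noteq> [] \<Longrightarrow> F (u # us) = 0"
    "linear (\<lambda>u. F [u])" "\<And>u. \<bar>F [u]\<bar> \<le> K * norm u"
    by auto
  have "bounded_linear (\<lambda>u. F [u])"
    using F(3,4) by (auto simp: bounded_linear_def bounded_linear_axioms_def mult.commute)
  then have "F us = (case us of [u] \<Rightarrow> blinfun_apply (Blinfun (\<lambda>u. F [u])) u | _ \<Rightarrow> 0)" for us
    using F(1,2) by (auto split: list.split simp: bounded_linear_Blinfun_apply)
  then show "\<exists>g :: 'a \<Rightarrow>\<^sub>L real. F = (\<lambda>us. case us of [u] \<Rightarrow> blinfun_apply g u | _ \<Rightarrow> 0)"
    by blast
next
  assume "\<exists>g :: 'a \<Rightarrow>\<^sub>L real. F = (\<lambda>us. case us of [u] \<Rightarrow> blinfun_apply g u | _ \<Rightarrow> 0)"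
  then obtain g :: "'a \<Rightarrow>\<^sub>L real"
    where F: "F = (\<lambda>us. case us of [u] \<Rightarrow> blinfun_apply g u | _ \<Rightarrow> 0)" by blast
  have "linear (\<lambda>u. F (u # us))" for us
    using F by (cases us) (auto simp: linear_iff blinfun.add_right blinfun.scaleR_right)
  moreover have "\<forall>u. \<bar>F [u]\<bar> \<le> norm g * norm u"
    using F norm_blinfun[of g] by simp
  ultimately show "F \<in> form_space 1"
    using F by (auto split: list.split)
qed

lemma form_norm_1:
  "form_norm 1 (\<lambda>us. case us of [u] \<Rightarrow> blinfun_apply g u | _ \<Rightarrow> 0) = norm (g :: 'a::real_normed_vector \<Rightarrow>\<^sub>L real)"
  by (simp add: norm_blinfun.rep_eq onorm_def)

text \<open>
  With \<open>xs = [x\<^sub>1, \<dots>, x\<^sub>n\<^sub>-\<^sub>1]\<close> this is the lower Hadamard derivative of order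
  \<open>n = Suc (length xs)\<close>; for \<open>xs = []\<close> it is the directional derivative of order 1. The limit
  variable \<open>u'\<close> ranges over full neighbourhoods of \<open>u\<close>, the value \<open>u' = u\<close> included. The
  notion is only meaningful for \<open>f x\<close> finite and each \<open>x\<^sub>i\<close> a subgradient of order \<open>i\<close> with
  respect to \<open>x\<^sub>1, \<dots>, x\<^sub>i\<^sub>-\<^sub>1\<close>.
\<close>

definition lower_hadamard_deriv ::
    "('a::real_normed_vector \<Rightarrow> ereal) \<Rightarrow> 'a \<Rightarrow> 'a form list \<Rightarrow> 'a \<Rightarrow> ereal" where
  "lower_hadamard_deriv f x xs u = (let n = Suc (length xs) in
     Liminf (at_right 0 \<times>\<^sub>F nhds u) (\<lambda>(t, u').
       ereal (fact n / t ^ n) *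
         (f (x + t *\<^sub>R u') - f x
           - ereal (\<Sum>i = 1..n - 1. t ^ i / fact i * (xs ! (i - 1)) (replicate i u')))))"

definition lower_hadamard_subdiff ::
    "('a::real_normed_vector \<Rightarrow> ereal) \<Rightarrow> 'a \<Rightarrow> 'a form list \<Rightarrow> 'a form set" where
  "lower_hadamard_subdiff f x xs = (let n = Suc (length xs) in
     {F \<in> form_space n. \<forall>u. ereal (F (replicate n u)) \<le> lower_hadamard_deriv f x xs u})"

definition edom :: "('a \<Rightarrow> ereal) \<Rightarrow> 'a set" where
  "edom f = {x. f x < \<infinity>}"

definition isolated_local_minimizer ::
    "nat \<Rightarrow> ('a::real_normed_vector \<Rightarrow> ereal) \<Rightarrow> 'a \<Rightarrow> bool" where
  "isolated_local_minimizer n f x \<longleftrightarrow> x \<in> edom f \<and>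
     (\<exists>N C. x \<in> interior N \<and> C > 0 \<and>
        (\<forall>y\<in>N. f y \<ge> f x + ereal (C * norm (y - x) ^ n)))"

end

theory Submission
  imports Defs
begin

text \<open>
  When all previous subgradients vanish, the lower derivative of order \<open>n\<close> at \<open>x\<close> is the lower
  limit of \<open>n!\<close> times the growth quotient \<open>(f y - f x) / t\<^sup>n\<close>, with \<open>y = x + t u'\<close>. A quotient is
  bounded below by a constant exactly if \<open>f\<close> grows at the corresponding rate along the step, so
  both sides of the equivalence speak of the same growth: the minimizer condition uniformly on a
  neighbourhood, the positivity of the derivative one direction at a time.

  Passing from the neighbourhood to a direction is immediate: \<open>\<parallel>y - x\<parallel> = t \<parallel>u'\<parallel>\<close>, and \<open>\<parallel>u'\<parallel>\<close>
  stays away from \<open>0\<close> near \<open>u \<noteq> 0\<close>. At any local minimizer all quotients of all orders are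
  eventually nonnegative, which gives the subgradient conditions. The converse rests on
  the finite dimension. The lower limit lets \<open>u'\<close> vary, so positivity at a unit vector \<open>u\<close> gives
  growth along a whole open cone of short steps around \<open>u\<close>; by compactness of the unit sphere,
  finitely many of these cones cover all directions (\<open>compact_directional_growth_uniform\<close>), and
  the worst of the finitely many rates holds in a punctured ball.
\<close>

text \<open>
  The value \<open>z\<close> may be infinite: this is what lets the growth condition include points outside
  the domain of \<open>f\<close>.
\<close>

lemma ereal_le_scaled_difference_iff:
  assumes "a > 0"
  shows "ereal c \<le> ereal a * (z - ereal r) \<longleftrightarrow> ereal r + ereal (c / a) \<le> z"
  using assms by (cases z) (auto simp: field_simps)

lemma lower_hadamard_deriv_zero_forms:
  "lower_hadamard_deriv f x (replicate k (\<lambda>us. 0)) u =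
    Liminf (at_right 0 \<times>\<^sub>F nhds u)
      (\<lambda>(t, u'). ereal (fact (Suc k) / t ^ Suc k) * (f (x + t *\<^sub>R u') - f x))"
proof -
  have "(\<Sum>i = 1..k. t ^ i / fact i * (replicate k (\<lambda>us. 0) ! (i - 1)) (replicate i u')) = 0"
    for t :: real and u' :: 'a
    by (rule sum.neutral) auto
  then show ?thesis
    by (simp only: lower_hadamard_deriv_def Let_def length_replicate diff_Suc_1)
       (simp flip: zero_ereal_def)
qed

lemma eventually_along_directions:
  fixes x u :: "'a::real_normed_vector"
  assumes "eventually P (nhds x)"
  shows "\<forall>\<^sub>F (t, u') in at_right 0 \<times>\<^sub>F nhds u. t > 0 \<and> P (x + t *\<^sub>R u')"
proof -
  let ?F = "at_right (0::real) \<times>\<^sub>F nhds u"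
  have t: "(fst \<longlongrightarrow> 0) ?F"
    by (rule filterlim_mono[OF filterlim_fst at_within_le_nhds order_refl])
  have u: "(snd \<longlongrightarrow> u) ?F"
    by (rule filterlim_snd)
  have "((\<lambda>p. x + fst p *\<^sub>R snd p) \<longlongrightarrow> x + 0 *\<^sub>R u) ?F"
    by (intro tendsto_intros t u)
  then have "\<forall>\<^sub>F p in ?F. P (x + fst p *\<^sub>R snd p)"
    using assms by (simp add: filterlim_iff)
  moreover have "\<forall>\<^sub>F p in ?F. fst p > 0"
    using filterlim_fst eventually_at_right_less[of 0]
    by (rule eventually_compose_filterlim[rotated])
  ultimately show ?thesis
    by eventually_elim (auto simp: case_prod_beta)
qed

text \<open>
  Along the steps \<open>x + t u'\<close> the norm \<open>\<parallel>u'\<parallel>\<close> is eventually at least \<open>\<parallel>u\<parallel> / 2\<close>, which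
  turns growth in \<open>\<parallel>y - x\<parallel>\<close> into growth in \<open>t\<close> at a positive rate.
\<close>

lemma isolated_local_minimizer_imp_deriv_pos:
  fixes f :: "'a::real_normed_vector \<Rightarrow> ereal"
  assumes min: "isolated_local_minimizer (Suc k) f x" and fx: "f x = ereal r" and u: "u \<noteq> 0"
  shows "lower_hadamard_deriv f x (replicate k (\<lambda>us. 0)) u > 0"
proof -
  obtain N C where N: "x \<in> interior N" and C: "C > 0"
    and growth: "\<And>y. y \<in> N \<Longrightarrow> f y \<ge> f x + ereal (C * norm (y - x) ^ Suc k)"
    using min unfolding isolated_local_minimizer_def by blast
  define c where "c = fact (Suc k) * (C * (norm u / 2) ^ Suc k)"
  have "c > 0"
    using C u by (simp add: c_def)
  have "eventually (\<lambda>y. y \<in> N) (nhds x)"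
    using N by (auto simp: eventually_nhds intro!: exI[of _ "interior N"] dest: interior_subset[THEN subsetD])
  then have "\<forall>\<^sub>F (t, u') in at_right 0 \<times>\<^sub>F nhds u. t > 0 \<and> x + t *\<^sub>R u' \<in> N"
    by (rule eventually_along_directions)
  moreover have "\<forall>\<^sub>F p in at_right (0::real) \<times>\<^sub>F nhds u. norm (snd p) > norm u / 2"
  proof (rule order_tendstoD(1))
    show "((\<lambda>p. norm (snd p)) \<longlongrightarrow> norm u) (at_right (0::real) \<times>\<^sub>F nhds u)"
      by (intro tendsto_norm filterlim_snd)
    show "norm u / 2 < norm u"
      using u by simp
  qed
  ultimately have "\<forall>\<^sub>F (t, u') in at_right 0 \<times>\<^sub>F nhds u.
      ereal c \<le> ereal (fact (Suc k) / t ^ Suc k) * (f (x + t *\<^sub>R u') - f x)"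
  proof eventually_elim
    case (elim p)
    obtain t u' where p: "p = (t, u')"
      by fastforce
    have t: "t > 0" and N': "x + t *\<^sub>R u' \<in> N" and u': "norm u / 2 < norm u'"
      using elim p by auto
    have "c / (fact (Suc k) / t ^ Suc k) = C * (t * (norm u / 2)) ^ Suc k"
      by (simp add: c_def power_mult_distrib power_divide)
    also have "\<dots> \<le> C * norm ((x + t *\<^sub>R u') - x) ^ Suc k"
      using t u' C by (intro mult_left_mono power_mono) auto
    finally have "ereal r + ereal (c / (fact (Suc k) / t ^ Suc k))
        \<le> f x + ereal (C * norm ((x + t *\<^sub>R u') - x) ^ Suc k)"
      by (simp add: fx)
    also have "\<dots> \<le> f (x + t *\<^sub>R u')"
      using growth[OF N'] .
    finally show ?case
      using t unfolding p prod.case fx by (subst ereal_le_scaled_difference_iff) auto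
  qed
  then have "ereal c \<le> lower_hadamard_deriv f x (replicate k (\<lambda>us. 0)) u"
    unfolding lower_hadamard_deriv_zero_forms
    by (intro Liminf_bounded) (auto elim!: eventually_mono simp del: fact_Suc power_Suc)
  then show ?thesis
    using \<open>c > 0\<close> by (meson ereal_less(2) less_le_trans)
qed

lemma local_minimizer_imp_zero_in_subdiff:
  fixes f :: "'a::real_normed_vector \<Rightarrow> ereal"
  assumes min: "\<forall>\<^sub>F y in nhds x. f x \<le> f y" and fx: "f x = ereal r"
  shows "(\<lambda>us. 0) \<in> lower_hadamard_subdiff f x (replicate k (\<lambda>us. 0))"
proof -
  have "0 \<le> lower_hadamard_deriv f x (replicate k (\<lambda>us. 0)) u" for u
    unfolding lower_hadamard_deriv_zero_forms
  proof (rule Liminf_bounded)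
    show "\<forall>\<^sub>F p in at_right 0 \<times>\<^sub>F nhds u.
        0 \<le> (case p of (t, u') \<Rightarrow>
          ereal (fact (Suc k) / t ^ Suc k) * (f (x + t *\<^sub>R u') - f x))"
      using eventually_along_directions[OF min]
    proof eventually_elim
      case (elim p)
      obtain t u' where p: "p = (t, u')"
        by fastforce
      have t: "t > 0" and le: "ereal r \<le> f (x + t *\<^sub>R u')"
        using elim p fx by auto
      show ?case
        using t le ereal_le_scaled_difference_iff[of "fact (Suc k) / t ^ Suc k" 0]
        unfolding p prod.case fx by (simp flip: zero_ereal_def)
    qed
  qed
  then show ?thesis
    using zero_in_form_space unfolding lower_hadamard_subdiff_def
    by (auto simp: Let_def simp del: form_space.simps simp flip: zero_ereal_def)
qed

text \<open>
  This is the compactness step: a property of triples (rate, step length, direction) that becomes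
  weaker as the rate decreases, and holds for short steps near each direction of a compact set,
  holds with one rate and one bound on the step length for the whole set.
\<close>

lemma compact_directional_growth_uniform:
  fixes S :: "'a::topological_space set"
  assumes S: "compact S"
    and ev: "\<And>u. u \<in> S \<Longrightarrow> \<exists>c>0. \<forall>\<^sub>F (t, u') in at_right 0 \<times>\<^sub>F nhds u. Q c t u'"
    and mono: "\<And>c c' t u'. Q c t u' \<Longrightarrow> c' \<le> c \<Longrightarrow> Q c' t u'"
  shows "\<exists>c>0::real. \<forall>u\<in>S. \<forall>t. 0 < t \<and> t < c \<longrightarrow> Q c t u"
proof -
  \<comment> \<open>One number \<open>m u\<close> serves as rate and as bound for the step length, so that a single minimum
    settles both.\<close>
  have "\<exists>U m. open U \<and> u \<in> U \<and> 0 < m \<and> (\<forall>u'\<in>U. \<forall>t. 0 < t \<and> t < m \<longrightarrow> Q m t u')"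
    if "u \<in> S" for u
  proof -
    obtain c where c: "c > 0" and "\<forall>\<^sub>F (t, u') in at_right 0 \<times>\<^sub>F nhds u. Q c t u'"
      using ev[OF \<open>u \<in> S\<close>] by blast
    then obtain P R where P: "eventually P (at_right 0)" and R: "eventually R (nhds u)"
      and PR: "\<And>t u'. P t \<Longrightarrow> R u' \<Longrightarrow> Q c t u'"
      unfolding eventually_prod_filter by auto
    obtain d where d: "d > 0" "\<And>t. 0 < t \<Longrightarrow> t < d \<Longrightarrow> P t"
      using P unfolding eventually_at_right_field by blast
    obtain U where U: "open U" "u \<in> U" "\<And>u'. u' \<in> U \<Longrightarrow> R u'"
      using R unfolding eventually_nhds by blast
    have "\<forall>u'\<in>U. \<forall>t. 0 < t \<and> t < min c d \<longrightarrow> Q (min c d) t u'"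
      using PR d(2) U(3) mono[of c] by auto
    then show ?thesis
      using U(1,2) c d(1) by (intro exI[of _ U] exI[of _ "min c d"]) auto
  qed
  then obtain U m where U: "\<And>u. u \<in> S \<Longrightarrow> open (U u)" "\<And>u. u \<in> S \<Longrightarrow> u \<in> U u"
    and m: "\<And>u. u \<in> S \<Longrightarrow> 0 < m u"
    and Q: "\<And>u u' t. \<lbrakk>u \<in> S; u' \<in> U u; 0 < t; t < m u\<rbrakk> \<Longrightarrow> Q (m u) t u'"
    by metis
  obtain D where D: "D \<subseteq> S" "finite D" "S \<subseteq> (\<Union>u\<in>D. U u)"
    using U by (rule_tac compactE_image[OF S, of S U]) auto
  \<comment> \<open>The extra element \<open>1\<close> only makes the minimum defined if \<open>S\<close> is empty.\<close>
  define c where "c = Min (insert 1 (m ` D))"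
  have "c > 0"
    using D m by (auto simp: c_def)
  moreover have "Q c t u" if "u \<in> S" "0 < t" "t < c" for t u
  proof -
    obtain v where v: "v \<in> D" "u \<in> U v"
      using D(3) \<open>u \<in> S\<close> by blast
    have "c \<le> m v"
      using D(2) v(1) by (simp add: c_def)
    then show ?thesis
      using Q[of v u t] mono[of "m v" t u c] that v D(1) by auto
  qed
  ultimately show ?thesis
    by blast
qed

text \<open>
  Every point \<open>y \<noteq> x\<close> is reached from \<open>x\<close> by the step of length \<open>t = \<parallel>y - x\<parallel>\<close> in the unit
  direction \<open>(y - x) / t\<close>, so a uniform bound for unit directions is a bound in a ball.
\<close>

lemma deriv_pos_imp_isolated_local_minimizer:
  fixes f :: "'a::euclidean_space \<Rightarrow> ereal"
  assumes pos: "\<And>u. norm u = 1 \<Longrightarrow> lower_hadamard_deriv f x (replicate k (\<lambda>us. 0)) u > 0"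
    and fx: "f x = ereal r"
  shows "isolated_local_minimizer (Suc k) f x"
proof -
  let ?q = "\<lambda>t u'. ereal (fact (Suc k) / t ^ Suc k) * (f (x + t *\<^sub>R u') - f x)"
  have "\<exists>c>0. \<forall>u\<in>sphere 0 1. \<forall>t. 0 < t \<and> t < c \<longrightarrow> ereal c \<le> ?q t u"
  proof (rule compact_directional_growth_uniform)
    fix u :: 'a
    assume "u \<in> sphere 0 1"
    then obtain c where c: "0 < ereal c"
      "ereal c < lower_hadamard_deriv f x (replicate k (\<lambda>us. 0)) u"
      using pos[of u] ereal_dense2 by force
    then have "\<forall>\<^sub>F p in at_right 0 \<times>\<^sub>F nhds u. ereal c < (case p of (t, u') \<Rightarrow> ?q t u')"
      unfolding lower_hadamard_deriv_zero_forms by (rule_tac less_LiminfD) auto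
    then have "\<forall>\<^sub>F (t, u') in at_right 0 \<times>\<^sub>F nhds u. ereal c \<le> ?q t u'"
      by eventually_elim (auto simp: case_prod_beta less_imp_le)
    with c(1) show "\<exists>c>0. \<forall>\<^sub>F (t, u') in at_right 0 \<times>\<^sub>F nhds u. ereal c \<le> ?q t u'"
      by auto
  next
    fix c c' t :: real and u' :: 'a
    assume "ereal c \<le> ?q t u'" "c' \<le> c"
    then show "ereal c' \<le> ?q t u'"
      by (meson ereal_less_eq(3) order_trans)
  qed simp
  then obtain c where c: "c > 0"
    and q: "\<And>t u. norm u = 1 \<Longrightarrow> 0 < t \<Longrightarrow> t < c \<Longrightarrow> ereal c \<le> ?q t u"
    by auto
  have "f x + ereal (c / fact (Suc k) * norm (y - x) ^ Suc k) \<le> f y" if "y \<in> ball x c" for y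
  proof (cases "y = x")
    case True
    then show ?thesis
      by simp
  next
    case False
    define t where "t = norm (y - x)"
    have t: "0 < t" "t < c"
      using that False by (auto simp: t_def dist_norm norm_minus_commute)
    define u where "u = (y - x) /\<^sub>R t"
    have u: "norm u = 1" "x + t *\<^sub>R u = y"
      using t by (auto simp: u_def) (simp add: t_def)
    have "ereal r + ereal (c / (fact (Suc k) / t ^ Suc k)) \<le> f y"
      using q[OF u(1) t] t unfolding u(2) fx
      by (subst (asm) ereal_le_scaled_difference_iff) auto
    then show ?thesis
      using t by (simp add: fx flip: t_def)
  qed
  moreover have "x \<in> interior (ball x c)" "c / fact (Suc k) > 0" "x \<in> edom f"
    using c fx by (auto simp: edom_def)
  ultimately show ?thesis
    unfolding isolated_local_minimizer_def by blast
qed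

theorem theorem4p2:
  fixes f :: "'a::euclidean_space \<Rightarrow> ereal" and xbar :: 'a and n :: nat
  assumes proper: "\<forall>x. f x \<noteq> -\<infinity>"
    and dom: "xbar \<in> edom f"
    and n: "n \<ge> 2"
  shows "isolated_local_minimizer n f xbar \<longleftrightarrow>
    (\<lambda>us. 0) \<in> lower_hadamard_subdiff f xbar [] \<and>
    (\<forall>i. 2 \<le> i \<and> i \<le> n - 1 \<longrightarrow>
       (\<lambda>us. 0) \<in> lower_hadamard_subdiff f xbar (replicate (i - 1) (\<lambda>us. 0))) \<and>
    (\<forall>u. u \<noteq> 0 \<longrightarrow> lower_hadamard_deriv f xbar (replicate (n - 1) (\<lambda>us. 0)) u > 0)"
    (is "?min \<longleftrightarrow> ?sub1 \<and> ?subs \<and> ?pos")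
proof -
  obtain r where fx: "f xbar = ereal r"
    using proper dom by (cases "f xbar") (auto simp: edom_def)
  have n_Suc: "Suc (n - 1) = n"
    using n by simp
  show ?thesis
  proof
    assume ?min
    then obtain N C where N: "xbar \<in> interior N" "C > 0"
      "\<And>y. y \<in> N \<Longrightarrow> f xbar + ereal (C * norm (y - xbar) ^ n) \<le> f y"
      unfolding isolated_local_minimizer_def by blast
    have "f xbar \<le> f y" if "y \<in> N" for y
    proof -
      have "f xbar \<le> f xbar + ereal (C * norm (y - xbar) ^ n)"
        using N(2) by (simp add: fx)
      then show ?thesis
        using N(3)[OF that] by (rule order_trans)
    qed
    then have "\<forall>\<^sub>F y in nhds xbar. f xbar \<le> f y"
      using N(1) by (auto simp: eventually_nhds intro!: exI[of _ "interior N"] dest: interior_subset[THEN subsetD])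
    then have sub: "(\<lambda>us. 0) \<in> lower_hadamard_subdiff f xbar (replicate k (\<lambda>us. 0))" for k
      using fx by (rule local_minimizer_imp_zero_in_subdiff)
    have ?pos
      using isolated_local_minimizer_imp_deriv_pos[of "n - 1" f xbar r] \<open>?min\<close> fx n_Suc by simp
    then show "?sub1 \<and> ?subs \<and> ?pos"
      using sub sub[of 0] by simp
  next
    assume "?sub1 \<and> ?subs \<and> ?pos"
    then have "lower_hadamard_deriv f xbar (replicate (n - 1) (\<lambda>us. 0)) u > 0"
      if "norm u = 1" for u
      using that by (metis norm_zero zero_neq_one)
    then have "isolated_local_minimizer (Suc (n - 1)) f xbar"
      using fx by (rule deriv_pos_imp_isolated_local_minimizer)
    then show ?min
      by (simp only: n_Suc)
  qed
qed

end
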